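(* Let $m,n\ge 1$ and let $A$ be a real symmetric positive-definite $n\times n$ matrix. Suppose $B:\mathbb{R}_+^m\to\mathbb{R}_+$ is twice differentiable, concave and increasing in each variable. If $u_j:\mathbb{R}_+\times\mathbb{R}^n\to\mathbb{R}_+$ satisfies $$\partial_t u_j\ge \operatorname{div}(A^{-1}\nabla u_j)$$ on $\mathbb{R}_+\times\mathbb{R}^n$ for all $j=1,\dots,m$, then $\widetilde u:=B(u_1,\dots,u_m)$ satisfies $$\partial_t\widetilde u\ge \operatorname{div}(A^{-1}\nabla\widetilde u).$$ Moreover, if the function $\Theta:\mathbb{R}^m\to\mathbb{R}$ given by $$\Theta(x_1,\dots,x_m):=\log B(e^{x_1},\dots,e^{x_m})$$ is convex and $$D^2(\log u_j)\ge -\frac{A}{2t}$$ for all $j=1,\dots,m$, then $$D^2(\log\widetilde u)\ge -\frac{A}{2t}.$$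
   Context: $\mathbb{R}_+=(0,\infty)$. Functions $u(t,x)$ have time variable $t\in\mathbb{R}_+$ and space variable $x\in\mathbb{R}^n$; $\operatorname{div}$, $\nabla$ and the Hessian $D^2$ act in the space variable $x$ only. All functions $u_j$ are assumed sufficiently regular (once continuously differentiable in $t$ and twice continuously differentiable in $x$). "Increasing in each variable" means nondecreasing, i.e. $\partial_j B\ge 0$ for each $j$. Matrix inequalities $P\ge Q$ mean that $P-Q$ is positive semidefinite, and inequalities are required or asserted at every point $(t,x)\in\mathbb{R}_+\times\mathbb{R}^n$. *)

theory Defs
  imports "HOL-Analysis.Analysis"
begin

definition pos_orthant :: "(real ^ 'm) set" where
  "pos_orthant = {x. \<forall>j. 0 < x $ j}"

definition pos_definite :: "real ^ 'n ^ 'n \<Rightarrow> bool" where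
  "pos_definite M \<longleftrightarrow> transpose M = M \<and> (\<forall>v. v \<noteq> 0 \<longrightarrow> 0 < v \<bullet> (M *v v))"

definition pos_semidefinite :: "real ^ 'n ^ 'n \<Rightarrow> bool" where
  "pos_semidefinite M \<longleftrightarrow> transpose M = M \<and> (\<forall>v. 0 \<le> v \<bullet> (M *v v))"

(* The order on matrices supplied by the library instance for vectors is entrywise;
   psd_ge is the order given by positive semidefiniteness of the difference. *)
definition psd_ge :: "real ^ 'n ^ 'n \<Rightarrow> real ^ 'n ^ 'n \<Rightarrow> bool" where
  "psd_ge P Q \<longleftrightarrow> pos_semidefinite (P - Q)"

definition partial_deriv :: "'n \<Rightarrow> (real ^ 'n \<Rightarrow> real) \<Rightarrow> real ^ 'n \<Rightarrow> real" where
  "partial_deriv i f x = deriv (\<lambda>s. f (x + s *\<^sub>R axis i 1)) 0"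

definition gradient :: "(real ^ 'n \<Rightarrow> real) \<Rightarrow> real ^ 'n \<Rightarrow> real ^ 'n" where
  "gradient f x = (\<chi> i. partial_deriv i f x)"

definition divergence :: "(real ^ 'n \<Rightarrow> real ^ 'n) \<Rightarrow> real ^ 'n \<Rightarrow> real" where
  "divergence F x = (\<Sum>i\<in>UNIV. partial_deriv i (\<lambda>y. F y $ i) x)"

definition hessian :: "(real ^ 'n \<Rightarrow> real) \<Rightarrow> real ^ 'n \<Rightarrow> real ^ 'n ^ 'n" where
  "hessian f x = (\<chi> i j. partial_deriv i (partial_deriv j f) x)"

(* Differentiability is in the Frechet sense; S is meant to be open. *)
definition twice_differentiable_on :: "(real ^ 'n) set \<Rightarrow> (real ^ 'n \<Rightarrow> real) \<Rightarrow> bool" where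
  "twice_differentiable_on S f \<longleftrightarrow>
     (\<forall>x\<in>S. f differentiable (at x) \<and> gradient f differentiable (at x))"

definition C2_on :: "(real ^ 'n) set \<Rightarrow> (real ^ 'n \<Rightarrow> real) \<Rightarrow> bool" where
  "C2_on S f \<longleftrightarrow> twice_differentiable_on S f \<and> continuous_on S (hessian f)"

(* The inequality is required for t > 0 only; values of u at t \<le> 0 are irrelevant. *)
definition heat_supersolution :: "real ^ 'n ^ 'n \<Rightarrow> (real \<Rightarrow> real ^ 'n \<Rightarrow> real) \<Rightarrow> bool" where
  "heat_supersolution A u \<longleftrightarrow>
     (\<forall>t>0. \<forall>x. deriv (\<lambda>s. u s x) t \<ge>
        divergence (\<lambda>y. matrix_inv A *v gradient (u t) y) x)"

definition log_hessian_bound :: "real ^ 'n ^ 'n \<Rightarrow> (real \<Rightarrow> real ^ 'n \<Rightarrow> real) \<Rightarrow> bool" where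
  "log_hessian_bound A u \<longleftrightarrow>
     (\<forall>t>0. \<forall>x. psd_ge (hessian (\<lambda>y. ln (u t y)) x) (- ((1 / (2 * t)) *\<^sub>R A)))"

end

theory Submission
  imports Defs
begin

text \<open>
  Both inequalities are instances of one comparison argument, which avoids expanding the second
  derivatives of a composition. Fix \<open>t\<close> and \<open>x\<close> and write \<open>U y = (u\<^sub>1 t y, \<dots>, u\<^sub>m t y)\<close>.

  Since \<open>B\<close> is concave it lies below its tangent plane at \<open>U x\<close>, so with
  \<open>c\<^sub>j = \<partial>\<^sub>j B (U x) \<ge> 0\<close> the function \<open>y \<mapsto> \<Sum>j. c\<^sub>j u\<^sub>j t y - B (U y)\<close> attains its minimum at \<open>x\<close>
  and its Hessian there is positive semidefinite (\<open>hessian_combination_nonneg_at_minimum\<close>).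
  Its trace against the positive semidefinite matrix \<open>A\<^sup>-\<^sup>1\<close> is therefore nonnegative
  (\<open>psd_trace_nonneg\<close>), which says that
  \<open>div (A\<^sup>-\<^sup>1 \<nabla>(B \<circ> U)) \<le> \<Sum>j. c\<^sub>j div (A\<^sup>-\<^sup>1 \<nabla>u\<^sub>j)\<close>. By the hypothesis on the \<open>u\<^sub>j\<close> and the chain rule
  in \<open>t\<close> the right-hand side is at most \<open>\<Sum>j. c\<^sub>j \<partial>\<^sub>t u\<^sub>j = \<partial>\<^sub>t (B \<circ> U)\<close>.

  For the logarithms, the convex function \<open>\<Theta>\<close> lies above its tangent plane at \<open>log U x\<close>. Its
  partial derivatives there are \<open>c\<^sub>j = \<partial>\<^sub>j B (U x) u\<^sub>j t x / B (U x) \<ge> 0\<close>, and the same argument gives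
  \<open>D\<^sup>2 (log (B \<circ> U)) \<ge> \<Sum>j. c\<^sub>j D\<^sup>2 (log u\<^sub>j) \<ge> - (\<Sum>j. c\<^sub>j) A / (2 t)\<close>. A positive concave function on the
  orthant grows at most linearly along rays, in the sense that \<open>\<nabla>B z \<bullet> z \<le> B z\<close>
  (\<open>concave_positive_radial_derivative_le\<close>), so \<open>\<Sum>j. c\<^sub>j \<le> 1\<close> and the bound follows.

  A matrix inequality also asserts symmetry. The composition is only twice
  differentiable, without continuity of its second derivatives, so symmetry of its
  Hessian needs Young's theorem in its pointwise form (\<open>hessian_symmetric\<close>).
\<close>

section \<open>Gradients and Hessians\<close>

lemma partial_deriv_eq:
  fixes f :: "real ^ 'n \<Rightarrow> real"
  assumes "(f has_derivative D) (at x)"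
  shows "partial_deriv i f x = D (axis i 1)"
proof -
  interpret D: bounded_linear D using assms by (rule has_derivative_bounded_linear)
  have "((\<lambda>s. f (x + s *\<^sub>R axis i 1)) has_derivative (\<lambda>s. D (s *\<^sub>R axis i 1))) (at 0)"
    by (rule has_derivative_compose[where f="\<lambda>s. x + s *\<^sub>R axis i 1" and g=f])
       (use assms in \<open>auto intro!: derivative_eq_intros\<close>)
  then have "((\<lambda>s. f (x + s *\<^sub>R axis i 1)) has_field_derivative D (axis i 1)) (at 0)"
    by (simp add: has_field_derivative_def D.scaleR mult_commute_abs)
  then show ?thesis unfolding partial_deriv_def by (rule DERIV_imp_deriv)
qed

lemma linear_eq_inner:
  fixes D :: "real ^ 'n \<Rightarrow> real"
  assumes "linear D"
  shows "D h = (\<chi> i. D (axis i 1)) \<bullet> h"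
proof -
  interpret D: linear D by fact
  have "D h = D (\<Sum>i\<in>UNIV. (h $ i) *\<^sub>R axis i 1)"
    using basis_expansion[of h] by (simp add: scalar_mult_eq_scaleR)
  also have "\<dots> = (\<Sum>i\<in>UNIV. h $ i * D (axis i 1))"
    by (simp add: D.sum D.scaleR)
  finally show ?thesis by (simp add: inner_vec_def mult.commute)
qed

lemma has_derivative_gradient:
  fixes f :: "real ^ 'n \<Rightarrow> real"
  assumes "f differentiable (at x)"
  shows "(f has_derivative (\<lambda>h. gradient f x \<bullet> h)) (at x)"
proof -
  obtain D where D: "(f has_derivative D) (at x)" using assms unfolding differentiable_def by blast
  have "D = (\<lambda>h. gradient f x \<bullet> h)"
    unfolding gradient_def partial_deriv_eq[OF D]
    using linear_eq_inner[OF has_derivative_linear[OF D]] by (intro ext)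
  with D show ?thesis by simp
qed

lemma gradient_eq:
  fixes f :: "real ^ 'n \<Rightarrow> real"
  assumes "(f has_derivative (\<lambda>h. g \<bullet> h)) (at x)"
  shows "gradient f x = g"
  by (simp add: gradient_def partial_deriv_eq[OF assms] vec_eq_iff inner_axis)

lemma hessian_eq:
  fixes f :: "real ^ 'n \<Rightarrow> real"
  assumes "(gradient f has_derivative D) (at x)"
  shows "hessian f x $ i $ j = D (axis i 1) $ j"
proof -
  have "((\<lambda>y. gradient f y $ j) has_derivative (\<lambda>h. D h $ j)) (at x)"
    using assms by (rule bounded_linear.has_derivative[OF bounded_linear_vec_nth])
  moreover have "(\<lambda>y. gradient f y $ j) = partial_deriv j f" by (simp add: gradient_def)
  ultimately show ?thesis by (simp add: hessian_def partial_deriv_eq)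
qed

lemma has_derivative_gradient_hessian:
  fixes f :: "real ^ 'n \<Rightarrow> real"
  assumes "gradient f differentiable (at x)"
  shows "(gradient f has_derivative (\<lambda>h. h v* hessian f x)) (at x)"
proof -
  obtain D where D: "(gradient f has_derivative D) (at x)"
    using assms unfolding differentiable_def by blast
  have "D h $ j = (h v* hessian f x) $ j" for h j
  proof -
    have "linear (\<lambda>h. D h $ j)"
      using bounded_linear.has_derivative[OF bounded_linear_vec_nth D] by (rule has_derivative_linear)
    from linear_eq_inner[OF this, of h] show ?thesis
      by (simp add: vector_matrix_mult_def inner_vec_def hessian_eq[OF D] mult.commute)
  qed
  then have "D = (\<lambda>h. h v* hessian f x)" by (simp add: vec_eq_iff fun_eq_iff)
  with D show ?thesis by simp
qed

lemma has_real_derivative_along_line: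
  fixes f :: "real ^ 'n \<Rightarrow> real"
  assumes "f differentiable (at (x + s *\<^sub>R v))"
  shows "((\<lambda>s. f (x + s *\<^sub>R v)) has_real_derivative gradient f (x + s *\<^sub>R v) \<bullet> v) (at s)"
proof -
  have "((\<lambda>s. f (x + s *\<^sub>R v)) has_derivative (\<lambda>h. gradient f (x + s *\<^sub>R v) \<bullet> (h *\<^sub>R v))) (at s)"
    by (rule has_derivative_compose[where f="\<lambda>s. x + s *\<^sub>R v" and g=f])
       (use has_derivative_gradient[OF assms] in \<open>auto intro!: derivative_eq_intros\<close>)
  then show ?thesis by (simp add: has_field_derivative_def mult_commute_abs)
qed

text \<open>
  The second difference over a parallelogram is \<open>\<phi> s - \<phi> 0\<close> with
  \<open>\<phi> \<theta> = f (x + s b + \<theta> a) - f (x + \<theta> a)\<close>. The mean value theorem turns it into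
  \<open>s (\<nabla>f (x + s b + \<theta> a) - \<nabla>f (x + \<theta> a)) \<bullet> a\<close>, and the linear approximation of
  \<open>\<nabla>f\<close> at \<open>x\<close>, applied at both points, leaves \<open>s\<^sup>2\<close> times the mixed derivative up to \<open>o(s\<^sup>2)\<close>.
\<close>
lemma second_difference_estimate:
  fixes f :: "real ^ 'n \<Rightarrow> real" and a b :: "real ^ 'n"
  assumes S: "open S" "x \<in> S" and f: "\<And>y. y \<in> S \<Longrightarrow> f differentiable (at y)"
    and g: "gradient f differentiable (at x)" and "0 < e"
  shows "\<exists>d>0. \<forall>s. 0 < s \<and> s < d \<longrightarrow>
    \<bar>f (x + s *\<^sub>R a + s *\<^sub>R b) - f (x + s *\<^sub>R a) - f (x + s *\<^sub>R b) + f x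
       - s\<^sup>2 * ((b v* hessian f x) \<bullet> a)\<bar> \<le> e * s\<^sup>2"
proof -
  define D where "D = (\<lambda>h. h v* hessian f x)"
  have D: "(gradient f has_derivative D) (at x)"
    using has_derivative_gradient_hessian[OF g] by (simp add: D_def)
  interpret D: bounded_linear D using D by (rule has_derivative_bounded_linear)
  \<comment> \<open>The two linearization errors add up to at most \<open>\<epsilon> s (2 |a| + |b|)\<close>; the summand 1 keeps \<open>C\<close> positive.\<close>
  define C where "C = (2 * norm a + norm b) * norm a + 1"
  have C: "C > 0" by (simp add: C_def add_nonneg_pos)
  define \<epsilon> where "\<epsilon> = e / C"
  have eps: "\<epsilon> > 0" using C \<open>0 < e\<close> by (simp add: \<epsilon>_def)
  obtain r where r: "r > 0" "\<And>y. norm (y - x) < r \<Longrightarrow>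
      norm (gradient f y - gradient f x - D (y - x)) \<le> \<epsilon> * norm (y - x)"
    using D[unfolded has_derivative_at_alt, THEN conjunct2, rule_format, OF eps] by auto
  obtain r' where r': "r' > 0" "ball x r' \<subseteq> S" using S open_contains_ball by blast
  define \<rho> where "\<rho> = min r r'"
  have rho: "\<rho> > 0" using r r' by (simp add: \<rho>_def)
  \<comment> \<open>For \<open>s < d\<close> the whole parallelogram spanned by \<open>s a\<close> and \<open>s b\<close> at \<open>x\<close> stays in the ball of radius \<open>\<rho>\<close>.\<close>
  define d where "d = \<rho> / (norm a + norm b + 1)"
  have nn: "norm a + norm b + 1 > 0" by (simp add: add_nonneg_pos)
  have "d > 0" using rho nn by (simp add: d_def)
  moreover have "\<bar>f (x + s *\<^sub>R a + s *\<^sub>R b) - f (x + s *\<^sub>R a) - f (x + s *\<^sub>R b) + f x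
       - s\<^sup>2 * (D b \<bullet> a)\<bar> \<le> e * s\<^sup>2" if s: "0 < s" "s < d" for s
  proof -
    have near: "norm (\<theta> *\<^sub>R a + \<sigma> *\<^sub>R b) < \<rho>" if "0 \<le> \<theta>" "\<theta> \<le> s" "0 \<le> \<sigma>" "\<sigma> \<le> s" for \<theta> \<sigma>
    proof -
      have "norm (\<theta> *\<^sub>R a + \<sigma> *\<^sub>R b) \<le> \<theta> * norm a + \<sigma> * norm b"
        using that norm_triangle_ineq[of "\<theta> *\<^sub>R a" "\<sigma> *\<^sub>R b"] by simp
      also have "\<dots> \<le> s * norm a + s * norm b"
        using that by (intro add_mono mult_right_mono) auto
      also have "\<dots> < s * (norm a + norm b + 1)" using s by (simp add: algebra_simps)
      also have "\<dots> < d * (norm a + norm b + 1)" using s nn by (intro mult_strict_right_mono)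
      also have "\<dots> = \<rho>" using nn by (simp add: d_def)
      finally show ?thesis .
    qed
    have diff: "f differentiable (at (x + \<theta> *\<^sub>R a + \<sigma> *\<^sub>R b))"
      if "0 \<le> \<theta>" "\<theta> \<le> s" "0 \<le> \<sigma>" "\<sigma> \<le> s" for \<theta> \<sigma>
    proof (rule f)
      have "dist x (x + h) = norm h" for h by (simp add: dist_norm)
      then have "x + (\<theta> *\<^sub>R a + \<sigma> *\<^sub>R b) \<in> ball x r'"
        using near[OF that] unfolding mem_ball \<rho>_def min_less_iff_conj by metis
      then show "x + \<theta> *\<^sub>R a + \<sigma> *\<^sub>R b \<in> S"
        using r'(2) by (auto simp only: add.assoc)
    qed
    define \<phi> where "\<phi> = (\<lambda>\<theta>. f ((x + s *\<^sub>R b) + \<theta> *\<^sub>R a) - f (x + \<theta> *\<^sub>R a))"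
    define \<phi>' where "\<phi>' = (\<lambda>\<theta>. gradient f ((x + s *\<^sub>R b) + \<theta> *\<^sub>R a) \<bullet> a - gradient f (x + \<theta> *\<^sub>R a) \<bullet> a)"
    have "\<exists>\<theta>>0. \<theta> < s \<and> \<phi> s - \<phi> 0 = (s - 0) * \<phi>' \<theta>"
    proof (rule MVT2)
      fix \<theta> assume \<theta>: "0 \<le> \<theta>" "\<theta> \<le> s"
      have 1: "f differentiable (at ((x + s *\<^sub>R b) + \<theta> *\<^sub>R a))"
        using diff[of \<theta> s] \<theta> s by (simp add: algebra_simps)
      have 2: "f differentiable (at (x + \<theta> *\<^sub>R a))"
        using diff[of \<theta> 0] \<theta> s by (simp add: algebra_simps)
      show "(\<phi> has_real_derivative \<phi>' \<theta>) (at \<theta>)"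
        unfolding \<phi>_def \<phi>'_def
        by (intro DERIV_diff has_real_derivative_along_line 1 2)
    qed (use s in auto)
    then obtain \<theta> where \<theta>: "0 < \<theta>" "\<theta> < s" "\<phi> s - \<phi> 0 = s * \<phi>' \<theta>" by auto
    define p where "p = \<theta> *\<^sub>R a + s *\<^sub>R b"
    define q where "q = \<theta> *\<^sub>R a"
    have p: "norm p < r" using near[of \<theta> s] \<theta> s by (simp add: p_def \<rho>_def)
    have q: "norm q < r" using near[of \<theta> 0] \<theta> s by (simp add: q_def \<rho>_def)
    let ?R = "\<lambda>h. gradient f (x + h) - gradient f x - D h"
    have "norm (?R p - ?R q) \<le> \<epsilon> * norm p + \<epsilon> * norm q"
      using norm_triangle_ineq4[of "?R p" "?R q"] r(2)[of "x + p"] r(2)[of "x + q"] p q by simp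
    also have "\<dots> \<le> \<epsilon> * (s * (2 * norm a + norm b))"
    proof -
      have "norm p \<le> \<theta> * norm a + s * norm b"
        using \<theta> s norm_triangle_ineq[of "\<theta> *\<^sub>R a" "s *\<^sub>R b"] by (simp add: p_def)
      moreover have "norm q = \<theta> * norm a" using \<theta> by (simp add: q_def)
      moreover have "\<theta> * norm a \<le> s * norm a" using \<theta> by (simp add: mult_right_mono)
      ultimately have "norm p + norm q \<le> s * (2 * norm a + norm b)"
        by (simp add: algebra_simps)
      from mult_left_mono[OF this, of \<epsilon>] show ?thesis using eps by (simp add: algebra_simps)
    qed
    finally have R: "norm (?R p - ?R q) \<le> \<epsilon> * (s * (2 * norm a + norm b))" .
    have "p - q = s *\<^sub>R b" by (simp add: p_def q_def)
    then have Dpq: "D p - D q = s *\<^sub>R D b" by (metis D.diff D.scaleR)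
    have "?R p - ?R q = gradient f (x + p) - gradient f (x + q) - (D p - D q)" by simp
    then have eq: "?R p - ?R q = gradient f (x + p) - gradient f (x + q) - s *\<^sub>R D b"
      by (simp only: Dpq)
    have "\<bar>\<phi>' \<theta> - s * (D b \<bullet> a)\<bar> = \<bar>(?R p - ?R q) \<bullet> a\<bar>"
      unfolding eq by (simp add: \<phi>'_def p_def q_def inner_diff_left algebra_simps)
    also have "\<dots> \<le> \<epsilon> * (s * (2 * norm a + norm b)) * norm a"
      using Cauchy_Schwarz_ineq2[of "?R p - ?R q" a] mult_right_mono[OF R norm_ge_zero[of a]] by linarith
    also have "\<dots> = s * (\<epsilon> * ((2 * norm a + norm b) * norm a))" by simp
    also have "\<dots> \<le> s * (\<epsilon> * C)"
      using s eps by (intro mult_left_mono) (auto simp: C_def)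
    also have "\<dots> = s * e" using C by (simp add: \<epsilon>_def)
    finally have *: "\<bar>\<phi>' \<theta> - s * (D b \<bullet> a)\<bar> \<le> s * e" .
    have "f (x + s *\<^sub>R a + s *\<^sub>R b) - f (x + s *\<^sub>R a) - f (x + s *\<^sub>R b) + f x = \<phi> s - \<phi> 0"
      by (simp add: \<phi>_def algebra_simps)
    then have "\<bar>f (x + s *\<^sub>R a + s *\<^sub>R b) - f (x + s *\<^sub>R a) - f (x + s *\<^sub>R b) + f x
       - s\<^sup>2 * (D b \<bullet> a)\<bar> = \<bar>s * (\<phi>' \<theta> - s * (D b \<bullet> a))\<bar>"
      by (simp add: \<theta>(3) power2_eq_square right_diff_distrib mult.assoc)
    also have "\<dots> \<le> s * (s * e)" using * s by (simp add: abs_mult)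
    finally show ?thesis by (simp add: power2_eq_square mult_ac)
  qed
  ultimately show ?thesis unfolding D_def by (intro exI[of _ d]) simp
qed

text \<open>
  Young's theorem: the second difference is symmetric in its two directions, hence so is its
  leading coefficient.
\<close>
theorem hessian_symmetric:
  fixes f :: "real ^ 'n \<Rightarrow> real"
  assumes S: "open S" "x \<in> S" and f: "twice_differentiable_on S f"
  shows "transpose (hessian f x) = hessian f x"
proof -
  let ?H = "hessian f x"
  have df: "\<And>y. y \<in> S \<Longrightarrow> f differentiable (at y)" and g: "gradient f differentiable (at x)"
    using f S by (auto simp: twice_differentiable_on_def)
  have sym: "(b v* ?H) \<bullet> a = (a v* ?H) \<bullet> b" for a b
  proof -
    have "\<bar>(b v* ?H) \<bullet> a - (a v* ?H) \<bullet> b\<bar> \<le> 0 + e" if "e > 0" for e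
    proof -
      have e2: "e / 2 > 0" using that by simp
      obtain d1 where d1: "d1 > 0" "\<And>s. 0 < s \<Longrightarrow> s < d1 \<Longrightarrow>
        \<bar>f (x + s *\<^sub>R a + s *\<^sub>R b) - f (x + s *\<^sub>R a) - f (x + s *\<^sub>R b) + f x
       - s\<^sup>2 * ((b v* ?H) \<bullet> a)\<bar> \<le> e / 2 * s\<^sup>2"
        using second_difference_estimate[OF S df g e2, of a b] by blast
      obtain d2 where d2: "d2 > 0" "\<And>s. 0 < s \<Longrightarrow> s < d2 \<Longrightarrow>
        \<bar>f (x + s *\<^sub>R b + s *\<^sub>R a) - f (x + s *\<^sub>R b) - f (x + s *\<^sub>R a) + f x
       - s\<^sup>2 * ((a v* ?H) \<bullet> b)\<bar> \<le> e / 2 * s\<^sup>2"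
        using second_difference_estimate[OF S df g e2, of b a] by blast
      define s where "s = min d1 d2 / 2"
      have s: "0 < s" "s < d1" "s < d2" using d1 d2 by (auto simp: s_def)
      have c: "x + s *\<^sub>R b + s *\<^sub>R a = x + s *\<^sub>R a + s *\<^sub>R b" by (simp add: add_ac)
      have "\<bar>s\<^sup>2 * ((b v* ?H) \<bullet> a) - s\<^sup>2 * ((a v* ?H) \<bullet> b)\<bar> \<le> e * s\<^sup>2"
        using d1(2)[OF s(1,2)] d2(2)[OF s(1,3)] unfolding c by linarith
      then have "s\<^sup>2 * \<bar>(b v* ?H) \<bullet> a - (a v* ?H) \<bullet> b\<bar> \<le> s\<^sup>2 * e"
        by (simp add: abs_mult mult.commute flip: right_diff_distrib)
      then show ?thesis using s by simp
    qed
    then have "\<bar>(b v* ?H) \<bullet> a - (a v* ?H) \<bullet> b\<bar> \<le> 0" by (rule field_le_epsilon)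
    then show ?thesis by simp
  qed
  have comp: "(axis i 1 v* ?H) \<bullet> axis j 1 = ?H $ i $ j" for i j
    by (simp add: inner_axis hessian_eq[OF has_derivative_gradient_hessian[OF g]])
  show ?thesis
    using sym[of "axis i 1" "axis j 1" for i j] by (simp add: vec_eq_iff transpose_def comp)
qed

lemma divergence_matrix_gradient:
  fixes f :: "real ^ 'n \<Rightarrow> real"
  assumes "gradient f differentiable (at x)"
  shows "divergence (\<lambda>y. P *v gradient f y) x = (\<Sum>i\<in>UNIV. \<Sum>k\<in>UNIV. P $ i $ k * hessian f x $ i $ k)"
proof -
  note g = has_derivative_gradient_hessian[OF assms]
  have "partial_deriv i (\<lambda>y. (P *v gradient f y) $ i) x = (\<Sum>k\<in>UNIV. P $ i $ k * hessian f x $ i $ k)" for i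
  proof -
    have "((\<lambda>y. (P *v gradient f y) $ i) has_derivative (\<lambda>h. (P *v (h v* hessian f x)) $ i)) (at x)"
      by (intro bounded_linear.has_derivative[OF bounded_linear_vec_nth]
          bounded_linear.has_derivative[OF matrix_vector_mul_bounded_linear] g)
    then show ?thesis
      by (simp add: partial_deriv_eq matrix_vector_mult_def hessian_eq[OF g])
  qed
  then show ?thesis by (simp add: divergence_def)
qed

section \<open>Linear combinations and compositions\<close>

lemma twice_differentiable_onI:
  fixes f :: "real ^ 'n \<Rightarrow> real"
  assumes f: "\<And>x. (f has_derivative (\<lambda>h. G x \<bullet> h)) (at x)"
    and G: "\<And>x. G differentiable (at x)"
  shows "gradient f = G" "twice_differentiable_on UNIV f"
proof -
  show "gradient f = G" using gradient_eq[OF f] by blast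
  then show "twice_differentiable_on UNIV f"
    using f G unfolding twice_differentiable_on_def differentiable_def by blast
qed

lemma
  fixes g :: "real ^ 'n \<Rightarrow> real" and w :: "'m::finite \<Rightarrow> real ^ 'n \<Rightarrow> real"
    and b :: real and c :: "'m \<Rightarrow> real"
  assumes g: "twice_differentiable_on UNIV g" and w: "\<And>j. twice_differentiable_on UNIV (w j)"
  defines "f \<equiv> \<lambda>y. b * g y + (\<Sum>j\<in>UNIV. c j * w j y)"
  shows twice_differentiable_linear_combination: "twice_differentiable_on UNIV f"
    and hessian_linear_combination: "hessian f x = b *\<^sub>R hessian g x + (\<Sum>j\<in>UNIV. c j *\<^sub>R hessian (w j) x)"
proof -
  define G where "G = (\<lambda>y. b *\<^sub>R gradient g y + (\<Sum>j\<in>UNIV. c j *\<^sub>R gradient (w j) y))"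
  have dg: "g differentiable (at y)" "gradient g differentiable (at y)"
    and dw: "w j differentiable (at y)" "gradient (w j) differentiable (at y)" for y j
    using g w by (auto simp: twice_differentiable_on_def)
  have f: "(f has_derivative (\<lambda>h. G y \<bullet> h)) (at y)" for y
    unfolding f_def G_def
    by (auto intro!: derivative_eq_intros has_derivative_gradient dg dw
        simp: inner_add_left inner_sum_left)
  have G: "(G has_derivative (\<lambda>h. b *\<^sub>R (h v* hessian g y) + (\<Sum>j\<in>UNIV. c j *\<^sub>R (h v* hessian (w j) y)))) (at y)" for y
    unfolding G_def
    by (intro has_derivative_add has_derivative_sum has_derivative_scaleR_right
        has_derivative_gradient_hessian dg dw)
  have Gd: "G differentiable (at y)" for y using G differentiable_def by blast
  note I = twice_differentiable_onI[of f G, OF f Gd]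
  show "twice_differentiable_on UNIV f" by (rule I)
  have "hessian f x $ i $ k = (b *\<^sub>R hessian g x + (\<Sum>j\<in>UNIV. c j *\<^sub>R hessian (w j) x)) $ i $ k" for i k
    using hessian_eq[of f, unfolded I(1), OF G]
    by (simp add: hessian_eq[OF has_derivative_gradient_hessian[OF dg(2)]]
        hessian_eq[OF has_derivative_gradient_hessian[OF dw(2)]])
  then show "hessian f x = b *\<^sub>R hessian g x + (\<Sum>j\<in>UNIV. c j *\<^sub>R hessian (w j) x)"
    by (simp add: vec_eq_iff)
qed

lemma has_derivative_vec_lambda:
  fixes w :: "'m::finite \<Rightarrow> 'a::real_normed_vector \<Rightarrow> real"
  assumes "\<And>j. (w j has_derivative w' j) F"
  shows "((\<lambda>y. \<chi> j. w j y) has_derivative (\<lambda>h. \<chi> j. w' j h)) F"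
proof -
  have "((\<lambda>y. \<Sum>j\<in>UNIV. w j y *\<^sub>R axis j (1::real)) has_derivative
      (\<lambda>h. \<Sum>j\<in>UNIV. w' j h *\<^sub>R axis j 1)) F"
    by (intro has_derivative_sum has_derivative_scaleR_left assms)
  moreover have "(\<Sum>j\<in>UNIV. r j *\<^sub>R axis j 1) = (\<chi> j. r j)" for r :: "'m \<Rightarrow> real"
    using basis_expansion[of "\<chi> j. r j"] by (simp add: scalar_mult_eq_scaleR)
  ultimately show ?thesis by simp
qed

lemma has_derivative_compose_family:
  fixes F :: "real ^ 'm \<Rightarrow> real" and w :: "'m \<Rightarrow> 'a::real_normed_vector \<Rightarrow> real"
  assumes F: "F differentiable (at (\<chi> j. w j y))"
    and w: "\<And>j. (w j has_derivative w' j) (at y)"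
  shows "((\<lambda>y. F (\<chi> j. w j y)) has_derivative
          (\<lambda>h. \<Sum>j\<in>UNIV. partial_deriv j F (\<chi> j. w j y) * w' j h)) (at y)"
proof -
  have "((\<lambda>y. \<chi> j. w j y) has_derivative (\<lambda>h. \<chi> j. w' j h)) (at y)"
    by (intro has_derivative_vec_lambda w)
  from has_derivative_compose[OF this has_derivative_gradient[OF F]]
  show ?thesis by (simp add: inner_vec_def gradient_def)
qed

lemma twice_differentiable_compose_family:
  fixes F :: "real ^ 'm \<Rightarrow> real" and w :: "'m \<Rightarrow> real ^ 'n \<Rightarrow> real"
  assumes F: "twice_differentiable_on S F" and w: "\<And>j. twice_differentiable_on UNIV (w j)"
    and S: "\<And>y. (\<chi> j. w j y) \<in> S"
  shows "twice_differentiable_on UNIV (\<lambda>y. F (\<chi> j. w j y))"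
proof (rule twice_differentiable_onI(2))
  let ?W = "\<lambda>y. \<chi> j. w j y"
  let ?G = "\<lambda>y. \<Sum>j\<in>UNIV. partial_deriv j F (?W y) *\<^sub>R gradient (w j) y"
  have dF: "F differentiable (at (?W y))" "gradient F differentiable (at (?W y))"
    and dw: "w j differentiable (at y)" "gradient (w j) differentiable (at y)" for y j
    using F w S by (auto simp: twice_differentiable_on_def)
  fix y
  show "((\<lambda>y. F (?W y)) has_derivative (\<lambda>h. ?G y \<bullet> h)) (at y)"
    using has_derivative_compose_family[OF dF(1) has_derivative_gradient[OF dw(1)]]
    by (simp add: inner_sum_left)
  have W: "?W differentiable (at y)"
    using has_derivative_vec_lambda[where w=w, OF has_derivative_gradient[OF dw(1)]]
    unfolding differentiable_def by blast
  have "(\<lambda>y. partial_deriv j F (?W y)) differentiable (at y)" for j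
  proof -
    have "(gradient F \<circ> ?W) differentiable (at y)" by (intro differentiable_chain_at W dF)
    then obtain D where "((\<lambda>y. gradient F (?W y)) has_derivative D) (at y)"
      unfolding differentiable_def o_def by blast
    then have "(\<lambda>y. gradient F (?W y) $ j) differentiable (at y)"
      using bounded_linear.has_derivative[OF bounded_linear_vec_nth] differentiable_def by blast
    then show ?thesis by (simp add: gradient_def)
  qed
  then show "?G differentiable (at y)"
    by (intro differentiable_sum ballI differentiable_scaleR dw) auto
qed

lemma twice_differentiable_ln:
  fixes f :: "real ^ 'n \<Rightarrow> real"
  assumes f: "twice_differentiable_on UNIV f" and pos: "\<And>y. 0 < f y"
  shows "twice_differentiable_on UNIV (\<lambda>y. ln (f y))"
proof (rule twice_differentiable_onI(2))
  fix y
  have df: "f differentiable (at y)" "gradient f differentiable (at y)"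
    using f by (auto simp: twice_differentiable_on_def)
  show "((\<lambda>y. ln (f y)) has_derivative (\<lambda>h. (inverse (f y) *\<^sub>R gradient f y) \<bullet> h)) (at y)"
    using pos[of y] by (auto intro!: derivative_eq_intros has_derivative_gradient df simp: divide_inverse)
  show "(\<lambda>y. inverse (f y) *\<^sub>R gradient f y) differentiable (at y)"
    using pos[of y] by (intro differentiable_scaleR differentiable_inverse df) auto
qed

section \<open>Second-order conditions at a minimum\<close>

text \<open>
  If the second derivative along \<open>v\<close> were negative, the first derivative along the line,
  which vanishes at the minimum, would be negative just after it, and the function would drop
  below its minimal value.
\<close>
lemma hessian_nonneg_at_minimum:
  fixes f :: "real ^ 'n \<Rightarrow> real"
  assumes f: "twice_differentiable_on UNIV f" and min: "\<And>y. f x \<le> f y"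
  shows "0 \<le> v \<bullet> (hessian f x *v v)"
proof (rule ccontr)
  assume "\<not> ?thesis"
  then have neg: "(v v* hessian f x) \<bullet> v < 0" by (simp add: dot_lmul_matrix)
  have df: "f differentiable (at y)" "gradient f differentiable (at y)" for y
    using f by (auto simp: twice_differentiable_on_def)
  define h where "h = (\<lambda>s. f (x + s *\<^sub>R v))"
  define k where "k = (\<lambda>s. gradient f (x + s *\<^sub>R v) \<bullet> v)"
  have h: "(h has_real_derivative k s) (at s)" for s
    unfolding h_def k_def by (rule has_real_derivative_along_line[OF df(1)])
  have "((\<lambda>s. gradient f (x + s *\<^sub>R v)) has_derivative (\<lambda>r. (r *\<^sub>R v) v* hessian f x)) (at 0)"
    by (rule has_derivative_compose[where f="\<lambda>s. x + s *\<^sub>R v" and g="gradient f"])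
       (use has_derivative_gradient_hessian[OF df(2)] in \<open>auto intro!: derivative_eq_intros\<close>)
  then have "(k has_derivative (\<lambda>r. ((r *\<^sub>R v) v* hessian f x) \<bullet> v)) (at 0)"
    unfolding k_def by (rule has_derivative_inner_left)
  then have k: "(k has_real_derivative (v v* hessian f x) \<bullet> v) (at 0)"
    by (simp add: has_field_derivative_def dot_lmul_matrix mult_commute_abs)
  have "k 0 = 0"
    using DERIV_local_min[OF h, of 1 0] min by (simp add: h_def)
  with DERIV_neg_dec_right[OF k neg] obtain d where d: "d > 0" "\<And>s. 0 < s \<Longrightarrow> s < d \<Longrightarrow> k s < 0"
    by auto
  obtain z where z: "0 < z" "z < d / 2" "h (d / 2) - h 0 = (d / 2 - 0) * k z"
    using MVT2[of 0 "d / 2" h k] d h by auto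
  have "(d / 2) * k z < 0" using d z by (intro mult_pos_neg) auto
  then show False using z min[of "x + (d / 2) *\<^sub>R v"] by (simp add: h_def)
qed

lemma hessian_combination_nonneg_at_minimum:
  fixes g :: "real ^ 'n \<Rightarrow> real" and w :: "'m::finite \<Rightarrow> real ^ 'n \<Rightarrow> real"
  assumes g: "twice_differentiable_on UNIV g" and w: "\<And>j. twice_differentiable_on UNIV (w j)"
    and min: "\<And>y. b * g x + (\<Sum>j\<in>UNIV. c j * w j x) \<le> b * g y + (\<Sum>j\<in>UNIV. c j * w j y)"
  shows "0 \<le> v \<bullet> ((b *\<^sub>R hessian g x + (\<Sum>j\<in>UNIV. c j *\<^sub>R hessian (w j) x)) *v v)"
  using hessian_nonneg_at_minimum[OF twice_differentiable_linear_combination[OF g w, where b=b and c=c], where x=x and v=v] min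
  by (simp add: hessian_linear_combination[OF g w])

section \<open>Positive semidefinite matrices\<close>

lemma bilinear_form_expand:
  "v \<bullet> (M *v w) = (\<Sum>i\<in>UNIV. \<Sum>k\<in>UNIV. v $ i * M $ i $ k * w $ k)" for M :: "real ^ 'n ^ 'm"
  by (simp add: inner_vec_def matrix_vector_mult_def sum_distrib_left mult.assoc)

text \<open>
  The trace of a product of two positive semidefinite matrices is nonnegative. Symmetric
  Gaussian elimination peels off a positive multiple of \<open>r r\<^sup>T\<close> for one row \<open>r\<close> of \<open>M\<close>. This contributes
  a positive multiple of \<open>r \<bullet> H r \<ge> 0\<close> to the trace, and a positive semidefinite matrix remains
  whose row at the pivot vanishes. The induction runs over a set of indices containing all nonzero rows.
\<close>
theorem psd_trace_nonneg:
  fixes M H :: "real ^ 'n ^ 'n"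
  assumes M: "pos_semidefinite M" and H: "\<And>v. 0 \<le> v \<bullet> (H *v v)"
  shows "0 \<le> (\<Sum>i\<in>UNIV. \<Sum>k\<in>UNIV. M $ i $ k * H $ i $ k)"
proof -
  have "0 \<le> (\<Sum>i\<in>UNIV. \<Sum>k\<in>UNIV. M $ i $ k * H $ i $ k)"
    if "finite S" "pos_semidefinite M" "\<And>i k. i \<notin> S \<Longrightarrow> M $ i $ k = 0" for S :: "'n set" and M
    using that
  proof (induction S arbitrary: M rule: finite_induct)
    case empty
    then show ?case by simp
  next
    case (insert a S)
    let ?r = "M $ a" and ?d = "M $ a $ a"
    have symT: "transpose M = M" and psd: "0 \<le> v \<bullet> (M *v v)" for v
      using insert.prems(1) by (auto simp: pos_semidefinite_def)
    have sym: "M $ i $ k = M $ k $ i" for i k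
      by (metis symT column_transpose column_def row_def vec_lambda_beta transpose_def)
    have row: "axis a 1 \<bullet> (M *v v) = ?r \<bullet> v" for v
    proof -
      have "axis a 1 \<bullet> (M *v v) = (M *v v) $ a" by (subst inner_commute) (simp add: inner_axis)
      then show ?thesis by (simp add: matrix_vector_mult_def inner_vec_def)
    qed
    have col: "v \<bullet> (M *v axis a 1) = ?r \<bullet> v" for v
      by (metis row symT dot_lmul_matrix inner_commute vector_transpose_matrix)
    have shift: "(v + s *\<^sub>R axis a 1) \<bullet> (M *v (v + s *\<^sub>R axis a 1)) = v \<bullet> (M *v v) + 2 * s * (?r \<bullet> v) + s\<^sup>2 * ?d" for v s
      by (simp add: matrix_vector_right_distrib matrix_vector_mult_scaleR inner_add_left inner_add_right row col
          inner_axis power2_eq_square algebra_simps)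
    show ?case
    proof (cases "?d = 0")
      case True
      \<comment> \<open>A zero diagonal entry forces a zero row: otherwise \<open>shift\<close> is affine and nonconstant in \<open>s\<close>, hence negative somewhere.\<close>
      have "?r \<bullet> v = 0" for v
      proof (rule ccontr)
        assume nz: "?r \<bullet> v \<noteq> 0"
        define s where "s = - (v \<bullet> (M *v v) + 1) / (2 * (?r \<bullet> v))"
        have "2 * s * (?r \<bullet> v) = - (v \<bullet> (M *v v) + 1)" using nz by (simp add: s_def)
        then show False using psd[of "v + s *\<^sub>R axis a 1"] shift[of v s] True by simp
      qed
      then have "?r = 0" using inner_eq_zero_iff by blast
      then have "M $ i $ k = 0" if "i \<notin> S" for i k
        using insert.prems(2)[of i k] that by (cases "i = a") auto
      then show ?thesis using insert.IH[of M] insert.prems(1) by blast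
    next
      case False
      have "0 \<le> ?d" using psd[of "axis a 1"] by (simp add: row inner_axis)
      with False have d: "0 < ?d" by simp
      \<comment> \<open>The Schur complement of the pivot \<open>M $ a $ a\<close>; its form at \<open>v\<close> is the minimum over \<open>s\<close> of \<open>shift\<close>.\<close>
      define N where "N = (\<chi> i k. M $ i $ k - ?r $ i * ?r $ k / ?d)"
      have Nform: "v \<bullet> (N *v v) = v \<bullet> (M *v v) - (?r \<bullet> v)\<^sup>2 / ?d" for v
        unfolding bilinear_form_expand N_def inner_vec_def[of ?r v] power2_eq_square
        by (simp add: algebra_simps sum_subtractf sum_product sum_divide_distrib)
      have "0 \<le> v \<bullet> (N *v v)" for v
      proof -
        have "0 \<le> v \<bullet> (M *v v) + 2 * (- (?r \<bullet> v) / ?d) * (?r \<bullet> v) + (- (?r \<bullet> v) / ?d)\<^sup>2 * ?d"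
          using psd[of "v + (- (?r \<bullet> v) / ?d) *\<^sub>R axis a 1"] unfolding shift .
        also have "\<dots> = v \<bullet> (N *v v)"
          using d by (simp add: Nform power2_eq_square field_simps)
        finally show ?thesis .
      qed
      moreover have "transpose N = N"
        by (simp add: N_def transpose_def vec_eq_iff sym mult.commute)
      ultimately have "pos_semidefinite N" by (simp add: pos_semidefinite_def)
      moreover have "N $ i $ k = 0" if "i \<notin> S" for i k
        using that insert.prems(2)[of i] sym[of a i] False by (cases "i = a") (auto simp: N_def)
      ultimately have IH: "0 \<le> (\<Sum>i\<in>UNIV. \<Sum>k\<in>UNIV. N $ i $ k * H $ i $ k)"
        using insert.IH[of N] by blast
      have "(\<Sum>i\<in>UNIV. \<Sum>k\<in>UNIV. M $ i $ k * H $ i $ k)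
          = (\<Sum>i\<in>UNIV. \<Sum>k\<in>UNIV. N $ i $ k * H $ i $ k) + ?r \<bullet> (H *v ?r) / ?d"
        unfolding bilinear_form_expand
        by (simp add: N_def algebra_simps sum_subtractf sum_divide_distrib)
      then show ?thesis using IH H[of ?r] d by (simp add: divide_nonneg_pos)
    qed
  qed
  from this[of UNIV M] show ?thesis using M by simp
qed

text \<open>With \<open>w = A\<^sup>-\<^sup>1 v\<close>, the form of \<open>A\<^sup>-\<^sup>1\<close> at \<open>v\<close> is the form of \<open>A\<close> at \<open>w\<close>.\<close>
lemma pos_semidefinite_matrix_inv:
  fixes A :: "real ^ 'n ^ 'n"
  assumes "pos_definite A"
  shows "pos_semidefinite (matrix_inv A)"
proof -
  have sym: "transpose A = A" and pos: "v \<noteq> 0 \<Longrightarrow> 0 < v \<bullet> (A *v v)" for v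
    using assms by (auto simp: pos_definite_def)
  have "A *v v = 0 \<Longrightarrow> v = 0" for v using pos[of v] by fastforce
  then have inv: "invertible A"
    by (metis invertible_left_inverse matrix_left_invertible_ker)
  let ?X = "matrix_inv A"
  have AA: "A ** ?X = mat 1" "?X ** A = mat 1"
    using someI_ex[OF inv[unfolded invertible_def]] unfolding matrix_inv_def by auto
  have "transpose ?X ** A = mat 1"
    using arg_cong[OF AA(1), of transpose] by (simp add: matrix_transpose_mul sym transpose_mat)
  then have "transpose ?X = ?X"
    by (metis AA(1) matrix_mul_assoc matrix_mul_lid matrix_mul_rid)
  moreover have "0 \<le> v \<bullet> (matrix_inv A *v v)" for v
  proof -
    define w where "w = matrix_inv A *v v"
    have "A *v w = v" by (simp add: w_def matrix_vector_mul_assoc AA)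
    then have "v \<bullet> (matrix_inv A *v v) = w \<bullet> (A *v w)" by (simp add: w_def inner_commute)
    then show ?thesis using pos[of w] by (cases "w = 0") auto
  qed
  ultimately show ?thesis by (simp add: pos_semidefinite_def)
qed

section \<open>Convexity\<close>

text \<open>
  The difference quotients of \<open>F\<close> along the segment from \<open>p\<close> to \<open>q\<close> are bounded by \<open>F q - F p\<close>,
  and they converge to the derivative at \<open>p\<close>.
\<close>
lemma convex_on_above_tangent:
  fixes F :: "'a::real_normed_vector \<Rightarrow> real"
  assumes F: "convex_on S F" and D: "(F has_derivative D) (at p)" and p: "p \<in> S" and q: "q \<in> S"
  shows "F p + D (q - p) \<le> F q"
proof -
  interpret D: bounded_linear D using D by (rule has_derivative_bounded_linear)
  have "((\<lambda>s. F (p + s *\<^sub>R (q - p))) has_derivative (\<lambda>s. D (s *\<^sub>R (q - p)))) (at 0)"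
    by (rule has_derivative_compose[where f="\<lambda>s. p + s *\<^sub>R (q - p)" and g=F])
       (use D in \<open>auto intro!: derivative_eq_intros\<close>)
  then have "((\<lambda>s. F (p + s *\<^sub>R (q - p))) has_real_derivative D (q - p)) (at 0)"
    by (simp add: has_field_derivative_def D.scaleR mult_commute_abs)
  then have "((\<lambda>s. (F (p + s *\<^sub>R (q - p)) - F p) / s) \<longlongrightarrow> D (q - p)) (at 0)"
    by (simp add: DERIV_def)
  then have "((\<lambda>s. (F (p + s *\<^sub>R (q - p)) - F p) / s) \<longlongrightarrow> D (q - p)) (at_right 0)"
    by (rule filterlim_mono) (auto simp: at_within_le_at)
  moreover have "\<forall>\<^sub>F s in at_right (0::real). (F (p + s *\<^sub>R (q - p)) - F p) / s \<le> F q - F p"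
    unfolding eventually_at_right_field
  proof (intro exI[of _ 1] conjI allI impI)
    fix s :: real assume s: "0 < s" "s < 1"
    have "p + s *\<^sub>R (q - p) = (1 - s) *\<^sub>R p + s *\<^sub>R q" by (simp add: algebra_simps)
    then have "F (p + s *\<^sub>R (q - p)) \<le> (1 - s) * F p + s * F q"
      using convex_onD[OF F, of s p q] s p q by simp
    then show "(F (p + s *\<^sub>R (q - p)) - F p) / s \<le> F q - F p"
      using s by (simp add: field_simps)
  qed simp
  ultimately have "D (q - p) \<le> F q - F p"
    by (intro tendsto_upperbound) auto
  then show ?thesis by simp
qed

text \<open>
  The tangent plane at \<open>p\<close> dominates \<open>B\<close>, so it is positive at \<open>e p\<close> for every \<open>0 < e < 1\<close>; letting
  \<open>e\<close> tend to 0 shows that its value \<open>B p - \<nabla>B p \<bullet> p\<close> at the origin is nonnegative.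
\<close>
lemma concave_positive_radial_derivative_le:
  fixes B :: "real ^ 'm \<Rightarrow> real"
  assumes pos: "\<And>z. z \<in> pos_orthant \<Longrightarrow> 0 < B z" and conc: "concave_on pos_orthant B"
    and diff: "B differentiable (at p)" and p: "p \<in> pos_orthant"
  shows "gradient B p \<bullet> p \<le> B p"
proof -
  have D: "((\<lambda>z. - B z) has_derivative (\<lambda>h. - (gradient B p \<bullet> h))) (at p)"
    using has_derivative_gradient[OF diff] by (rule has_derivative_minus)
  have "(1 - e) * (gradient B p \<bullet> p) \<le> B p" if e: "0 < e" "e < 1" for e
  proof -
    have ep: "e *\<^sub>R p \<in> pos_orthant" using e p by (simp add: pos_orthant_def)
    have "- B p + - (gradient B p \<bullet> (e *\<^sub>R p - p)) \<le> - B (e *\<^sub>R p)"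
      using convex_on_above_tangent[OF conc[unfolded concave_on_def] D p ep] .
    then show ?thesis using pos[OF ep] by (simp add: algebra_simps inner_diff_right)
  qed
  then have "\<forall>\<^sub>F e in at_right 0. (1 - e) * (gradient B p \<bullet> p) \<le> B p"
    unfolding eventually_at_right_field by (intro exI[of _ 1]) auto
  moreover have "((\<lambda>e. (1 - e) * (gradient B p \<bullet> p)) \<longlongrightarrow> (1 - 0) * (gradient B p \<bullet> p)) (at_right 0)"
    by (intro tendsto_intros)
  ultimately show ?thesis using tendsto_upperbound by fastforce
qed

section \<open>Composition of supersolutions\<close>

text \<open>
  The tangent plane of \<open>B\<close> touches \<open>B \<circ> U\<close> from above at \<open>x\<close>; at a point of contact the Hessians are
  ordered, and so are their traces against \<open>A\<^sup>-\<^sup>1\<close>.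
\<close>
theorem heat_supersolution_compose:
  fixes A :: "real ^ 'n ^ 'n" and B :: "real ^ 'm \<Rightarrow> real"
    and u :: "'m \<Rightarrow> real \<Rightarrow> real ^ 'n \<Rightarrow> real"
  assumes A: "pos_definite A"
    and B: "twice_differentiable_on pos_orthant B" "concave_on pos_orthant B"
    and incr: "\<And>z j. z \<in> pos_orthant \<Longrightarrow> 0 \<le> partial_deriv j B z"
    and pos: "\<And>j t x. 0 < t \<Longrightarrow> 0 < u j t x"
    and ut: "\<And>j t x. 0 < t \<Longrightarrow> (\<lambda>s. u j s x) differentiable (at t)"
    and ux: "\<And>j t. 0 < t \<Longrightarrow> twice_differentiable_on UNIV (u j t)"
    and super: "\<And>j. heat_supersolution A (u j)"
  shows "heat_supersolution A (\<lambda>t x. B (\<chi> j. u j t x))"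
  unfolding heat_supersolution_def
proof (intro allI impI)
  fix t :: real and x :: "real ^ 'n" assume t: "0 < t"
  define p where "p = (\<chi> j. u j t x)"
  define c where "c = (\<lambda>j. partial_deriv j B p)"
  let ?g = "\<lambda>y. B (\<chi> j. u j t y)"
  let ?P = "matrix_inv A"
  have U: "(\<chi> j. u j t y) \<in> pos_orthant" for y using pos[OF t] by (simp add: pos_orthant_def)
  have pU: "p \<in> pos_orthant" unfolding p_def by (rule U)
  have dB: "B differentiable (at p)" using B(1) pU by (simp add: twice_differentiable_on_def)
  have g: "twice_differentiable_on UNIV ?g"
    by (rule twice_differentiable_compose_family[OF B(1) ux[OF t] U])
  have tangent: "- 1 * ?g x + (\<Sum>j\<in>UNIV. c j * u j t x) \<le> - 1 * ?g y + (\<Sum>j\<in>UNIV. c j * u j t y)" for y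
  proof -
    have "- B p + - (gradient B p \<bullet> ((\<chi> j. u j t y) - p)) \<le> - B (\<chi> j. u j t y)"
      using convex_on_above_tangent[OF B(2)[unfolded concave_on_def]
          has_derivative_minus[OF has_derivative_gradient[OF dB]] pU U] .
    then show ?thesis
      by (simp add: p_def c_def gradient_def inner_vec_def right_diff_distrib sum_subtractf)
  qed
  let ?H = "- 1 *\<^sub>R hessian ?g x + (\<Sum>j\<in>UNIV. c j *\<^sub>R hessian (u j t) x)"
  have "0 \<le> v \<bullet> (?H *v v)" for v
    by (rule hessian_combination_nonneg_at_minimum[OF g ux[OF t] tangent])
  then have "0 \<le> (\<Sum>i\<in>UNIV. \<Sum>k\<in>UNIV. ?P $ i $ k * ?H $ i $ k)"
    by (intro psd_trace_nonneg pos_semidefinite_matrix_inv A)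
  also have "\<dots> = - (\<Sum>i\<in>UNIV. \<Sum>k\<in>UNIV. ?P $ i $ k * hessian ?g x $ i $ k)
      + (\<Sum>i\<in>UNIV. \<Sum>k\<in>UNIV. \<Sum>j\<in>UNIV. c j * (?P $ i $ k * hessian (u j t) x $ i $ k))"
    by (simp add: distrib_left sum.distrib sum_negf sum_distrib_left
        right_diff_distrib sum_subtractf mult_ac)
  also have "(\<Sum>i\<in>UNIV. \<Sum>k\<in>UNIV. \<Sum>j\<in>UNIV. c j * (?P $ i $ k * hessian (u j t) x $ i $ k))
      = (\<Sum>j\<in>UNIV. c j * (\<Sum>i\<in>UNIV. \<Sum>k\<in>UNIV. ?P $ i $ k * hessian (u j t) x $ i $ k))"
    by (simp add: sum_distrib_left sum.swap[of _ "UNIV :: 'm set"])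
  finally have "divergence (\<lambda>y. ?P *v gradient ?g y) x
      \<le> (\<Sum>j\<in>UNIV. c j * divergence (\<lambda>y. ?P *v gradient (u j t) y) x)"
    using g ux[OF t] by (simp add: divergence_matrix_gradient twice_differentiable_on_def)
  also have "\<dots> \<le> (\<Sum>j\<in>UNIV. c j * deriv (\<lambda>s. u j s x) t)"
    using super incr[OF pU] t unfolding heat_supersolution_def c_def
    by (intro sum_mono mult_left_mono) auto
  also have "\<dots> = deriv (\<lambda>s. B (\<chi> j. u j s x)) t"
  proof -
    have "((\<lambda>s. u j s x) has_derivative (\<lambda>h. deriv (\<lambda>s. u j s x) t * h)) (at t)" for j
      using ut[OF t, of j x] DERIV_deriv_iff_real_differentiable has_field_derivative_def by blast
    from has_derivative_compose_family[where F=B, OF dB[unfolded p_def] this]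
    have "((\<lambda>s. B (\<chi> j. u j s x)) has_real_derivative (\<Sum>j\<in>UNIV. c j * deriv (\<lambda>s. u j s x) t)) (at t)"
      unfolding has_field_derivative_def
      by (rule has_derivative_eq_rhs) (simp add: c_def p_def sum_distrib_left mult_ac fun_eq_iff)
    then show ?thesis by (simp add: DERIV_imp_deriv)
  qed
  finally show "divergence (\<lambda>y. ?P *v gradient ?g y) x \<le> deriv (\<lambda>s. B (\<chi> j. u j s x)) t" .
qed

text \<open>
  The same contact argument in logarithmic coordinates, from below. The coefficients \<open>c\<close> of the tangent
  plane are the partial derivatives of \<open>\<Theta>\<close>; concavity of \<open>B\<close> bounds their sum by 1,
  which preserves the constant in the Hessian bound.
\<close>
theorem log_hessian_bound_compose:
  fixes A :: "real ^ 'n ^ 'n" and B :: "real ^ 'm \<Rightarrow> real"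
    and u :: "'m \<Rightarrow> real \<Rightarrow> real ^ 'n \<Rightarrow> real"
  assumes A: "pos_semidefinite A"
    and Bpos: "\<And>z. z \<in> pos_orthant \<Longrightarrow> 0 < B z"
    and B: "twice_differentiable_on pos_orthant B" "concave_on pos_orthant B"
    and incr: "\<And>z j. z \<in> pos_orthant \<Longrightarrow> 0 \<le> partial_deriv j B z"
    and pos: "\<And>j t x. 0 < t \<Longrightarrow> 0 < u j t x"
    and ux: "\<And>j t. 0 < t \<Longrightarrow> twice_differentiable_on UNIV (u j t)"
    and conv: "convex_on UNIV (\<lambda>x :: real ^ 'm. ln (B (\<chi> j. exp (x $ j))))"
    and bound: "\<And>j. log_hessian_bound A (u j)"
  shows "log_hessian_bound A (\<lambda>t x. B (\<chi> j. u j t x))"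
  unfolding log_hessian_bound_def
proof (intro allI impI)
  fix t :: real and x :: "real ^ 'n" assume t: "0 < t"
  define p where "p = (\<chi> j. u j t x)"
  define c where "c = (\<lambda>j. partial_deriv j B p * p $ j / B p)"
  let ?g = "\<lambda>y. ln (B (\<chi> j. u j t y))"
  let ?w = "\<lambda>j y. ln (u j t y)"
  have U: "(\<chi> j. u j t y) \<in> pos_orthant" for y using pos[OF t] by (simp add: pos_orthant_def)
  have pU: "p \<in> pos_orthant" unfolding p_def by (rule U)
  have dB: "B differentiable (at p)" using B(1) pU by (simp add: twice_differentiable_on_def)
  have g: "twice_differentiable_on UNIV ?g"
    by (intro twice_differentiable_ln twice_differentiable_compose_family[OF B(1) ux[OF t] U] Bpos U)
  have w: "twice_differentiable_on UNIV (?w j)" for j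
    by (intro twice_differentiable_ln ux pos t)
  have c0: "0 \<le> c j" for j
    using incr[OF pU] Bpos[OF pU] pU by (simp add: c_def pos_orthant_def less_imp_le)
  have c1: "(\<Sum>j\<in>UNIV. c j) \<le> 1"
  proof -
    have "(\<Sum>j\<in>UNIV. c j) = gradient B p \<bullet> p / B p"
      by (simp add: c_def gradient_def inner_vec_def sum_divide_distrib)
    also have "\<dots> \<le> 1"
      using concave_positive_radial_derivative_le[OF Bpos B(2) dB pU] Bpos[OF pU] by simp
    finally show ?thesis .
  qed
  have tangent: "1 * ?g x + (\<Sum>j\<in>UNIV. - c j * ?w j x) \<le> 1 * ?g y + (\<Sum>j\<in>UNIV. - c j * ?w j y)" for y
  proof -
    define q where "q = (\<chi> j. ?w j x)"
    let ?\<Theta> = "\<lambda>x :: real ^ 'm. ln (B (\<chi> j. exp (x $ j)))"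
    have ex: "(\<chi> j. exp (q $ j)) = p" using pos[OF t] by (simp add: q_def p_def)
    have dB': "B differentiable (at (\<chi> j. exp (q $ j)))" using dB by (simp only: ex)
    have "((\<lambda>x. exp (x $ j)) has_derivative (\<lambda>h. h $ j * exp (q $ j))) (at q)" for j
      by (rule has_derivative_exp[THEN has_derivative_eq_rhs])
         (auto intro!: bounded_linear.has_derivative[OF bounded_linear_vec_nth] has_derivative_ident
           simp: mult.commute)
    from has_derivative_compose_family[OF dB' this]
    have "((\<lambda>x. B (\<chi> j. exp (x $ j))) has_derivative
        (\<lambda>h. \<Sum>j\<in>UNIV. partial_deriv j B p * (h $ j * exp (q $ j)))) (at q)"
      by (simp only: ex)
    from has_derivative_ln[OF _ this]
    have D: "(?\<Theta> has_derivative (\<lambda>h. \<Sum>j\<in>UNIV. c j * h $ j)) (at q)"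
      using Bpos[OF pU] pos[OF t]
      by (simp add: ex c_def sum_distrib_left sum_distrib_right divide_inverse mult_ac p_def q_def)
    have "?\<Theta> q + (\<Sum>j\<in>UNIV. c j * ((\<chi> j. ?w j y) - q) $ j) \<le> ?\<Theta> (\<chi> j. ?w j y)"
      by (rule convex_on_above_tangent[OF conv D]) auto
    then show ?thesis
      using pos[OF t] by (simp add: q_def right_diff_distrib sum_subtractf sum_negf)
  qed
  have quad: "(\<Sum>j\<in>UNIV. c j * (v \<bullet> (hessian (?w j) x *v v))) \<le> v \<bullet> (hessian ?g x *v v)" for v
    using hessian_combination_nonneg_at_minimum[OF g w tangent, of v]
    by (simp add: matrix_vector_mult_add_rdistrib inner_add_right scaleR_matrix_vector_assoc[symmetric]
      sum_negf matrix_vector_mult_diff_rdistrib inner_diff_right bilinear_form_expand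
      algebra_simps sum_distrib_left sum_subtractf sum.swap[of _ "UNIV :: 'm set"])
  have A': "transpose A = A" "0 \<le> v \<bullet> (A *v v)" for v
    using A by (auto simp: pos_semidefinite_def)
  define k where "k = 1 / (2 * t)"
  have k: "0 \<le> k" using t by (simp add: k_def)
  have form: "v \<bullet> ((M - - (k *\<^sub>R A)) *v v) = v \<bullet> (M *v v) + k * (v \<bullet> (A *v v))" for v M
    by (simp add: matrix_vector_mult_add_rdistrib inner_add_right scaleR_matrix_vector_assoc[symmetric])
  have "0 \<le> v \<bullet> ((hessian ?g x - - (k *\<^sub>R A)) *v v)" for v
  proof -
    let ?a = "k * (v \<bullet> (A *v v))"
    have a: "0 \<le> ?a" using A'(2) k by simp
    have "- ?a \<le> v \<bullet> (hessian (?w j) x *v v)" for j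
    proof -
      have "0 \<le> v \<bullet> ((hessian (?w j) x - - (k *\<^sub>R A)) *v v)"
        using bound[of j] t unfolding log_hessian_bound_def psd_ge_def pos_semidefinite_def k_def by blast
      then show ?thesis unfolding form by linarith
    qed
    then have "(\<Sum>j\<in>UNIV. c j * (- ?a)) \<le> (\<Sum>j\<in>UNIV. c j * (v \<bullet> (hessian (?w j) x *v v)))"
      by (intro sum_mono mult_left_mono c0)
    moreover have "- ?a \<le> (\<Sum>j\<in>UNIV. c j * (- ?a))"
      using mult_right_mono[OF c1 a] by (simp add: sum_negf flip: sum_distrib_right)
    ultimately show ?thesis using quad[of v] form[of v "hessian ?g x"] by linarith
  qed
  moreover have "transpose (hessian ?g x - - (k *\<^sub>R A)) = hessian ?g x - - (k *\<^sub>R A)"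
    using hessian_symmetric[OF open_UNIV UNIV_I g, of x] A'(1)
    by (simp add: transpose_def vec_eq_iff)
  ultimately show "psd_ge (hessian ?g x) (- ((1 / (2 * t)) *\<^sub>R A))"
    unfolding psd_ge_def pos_semidefinite_def k_def by blast
qed

theorem theorem3p1:
  fixes A :: "real ^ 'n ^ 'n"
    and B :: "real ^ 'm \<Rightarrow> real"
    and u :: "'m \<Rightarrow> real \<Rightarrow> real ^ 'n \<Rightarrow> real"
  assumes A_pos: "pos_definite A"
    and B_pos: "\<And>z. z \<in> pos_orthant \<Longrightarrow> 0 < B z"
    and B_diff: "twice_differentiable_on pos_orthant B"
    and B_concave: "concave_on pos_orthant B"
    and B_incr: "\<And>z j. z \<in> pos_orthant \<Longrightarrow> 0 \<le> partial_deriv j B z"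
    and u_pos: "\<And>j t x. 0 < t \<Longrightarrow> 0 < u j t x"
    and u_C1_t: "\<And>j x. (\<lambda>t. u j t x) C1_differentiable_on {0<..}"
    and u_C2_x: "\<And>j t. 0 < t \<Longrightarrow> C2_on UNIV (u j t)"
    and u_super: "\<And>j. heat_supersolution A (u j)"
  shows "heat_supersolution A (\<lambda>t x. B (\<chi> j. u j t x)) \<and>
    (convex_on UNIV (\<lambda>x :: real ^ 'm. ln (B (\<chi> j. exp (x $ j)))) \<and>
     (\<forall>j. log_hessian_bound A (u j))
     \<longrightarrow> log_hessian_bound A (\<lambda>t x. B (\<chi> j. u j t x)))"
proof (intro conjI impI)
  have ut: "(\<lambda>s. u j s x) differentiable (at t)" if "0 < t" for j t x
    using u_C1_t[of j x] that unfolding C1_differentiable_on_def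
    by (metis differentiableI_vector greaterThan_iff)
  have ux: "twice_differentiable_on UNIV (u j t)" if "0 < t" for j t
    using u_C2_x[OF that] by (simp add: C2_on_def)
  have A: "pos_semidefinite A"
    using A_pos unfolding pos_definite_def pos_semidefinite_def by (metis inner_zero_left less_imp_le order_refl)
  show "heat_supersolution A (\<lambda>t x. B (\<chi> j. u j t x))"
    by (rule heat_supersolution_compose[OF A_pos B_diff B_concave B_incr u_pos ut ux u_super])
  assume "convex_on UNIV (\<lambda>x :: real ^ 'm. ln (B (\<chi> j. exp (x $ j)))) \<and> (\<forall>j. log_hessian_bound A (u j))"
  then show "log_hessian_bound A (\<lambda>t x. B (\<chi> j. u j t x))"
    by (intro log_hessian_bound_compose[OF A B_pos B_diff B_concave B_incr u_pos ux]) auto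
qed

end
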